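(* Let $k\ge 1$ and let $\tau$ be a pattern (permutation) of length $k+1$. Let $G=(V,E)$ be a graph whose vertices are labeled by distinct elements of a totally ordered set and which is represented by some word avoiding $\tau$. Let $x\in V$ have degree $d(x)\ge k$. Then every word $w$ that represents $G$ and avoids $\tau$ contains at most $k$ occurrences of $x$.
   Context: All graphs are simple; $d(x)$ is the degree of vertex $x$. A word is a finite sequence of letters from a totally ordered alphabet. Two letters $x,y$ alternate in a word $w$ if between any two occurrences of $x$ there is an occurrence of $y$ and between any two occurrences of $y$ there is an occurrence of $x$. A graph $G=(V,E)$ is represented by a word $w$ over $V$ if for all distinct $x,y\in V$, $x$ and $y$ alternate in $w$ if and only if $xy\in E$. A word $w=w_1\cdots w_n$ contains a pattern $\tau=\tau_1\cdots\tau_m$ if some subsequence $w_{i_1}\cdots w_{i_m}$ ($i_1<\dots<i_m$) is order-isomorphic to $\tau$; otherwise it avoids $\tau$. *)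

theory Defs
  imports
    "HOL-Library.Sublist"
    "HOL-Library.Extended_Nat"
    "HOL-Combinatorics.Multiset_Permutations"
begin

text \<open>A graph is given by its vertex set and its set of edges, an edge being a two-element set of
  vertices. Vertices are identified with their labels, so they are themselves the letters of words.\<close>

definition simple_graph :: "'a set \<Rightarrow> 'a set set \<Rightarrow> bool" where
  "simple_graph V E \<longleftrightarrow> (\<forall>e\<in>E. e \<subseteq> V \<and> card e = 2)"

definition nbhd :: "'a set \<Rightarrow> 'a set set \<Rightarrow> 'a \<Rightarrow> 'a set" where
  "nbhd V E x = {y \<in> V. {x, y} \<in> E}"

text \<open>Graphs are not assumed to be finite. The degree is an extended natural number because
  \<^const>\<open>card\<close> is \<open>0\<close> on an infinite neighbourhood.\<close>

definition degree :: "'a set \<Rightarrow> 'a set set \<Rightarrow> 'a \<Rightarrow> enat" where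
  "degree V E x = (if finite (nbhd V E x) then enat (card (nbhd V E x)) else \<infinity>)"

definition alternate :: "'a \<Rightarrow> 'a \<Rightarrow> 'a list \<Rightarrow> bool" where
  "alternate x y w \<longleftrightarrow>
     (\<forall>i j. i < j \<and> j < length w \<and> w ! i = x \<and> w ! j = x \<longrightarrow> (\<exists>m. i < m \<and> m < j \<and> w ! m = y)) \<and>
     (\<forall>i j. i < j \<and> j < length w \<and> w ! i = y \<and> w ! j = y \<longrightarrow> (\<exists>m. i < m \<and> m < j \<and> w ! m = x))"

text \<open>A word over \<open>V\<close> uses letters from \<open>V\<close> only. It is not required to use all of them.\<close>

definition represents :: "'a list \<Rightarrow> 'a set \<Rightarrow> 'a set set \<Rightarrow> bool" where
  "represents w V E \<longleftrightarrow>
     set w \<subseteq> V \<and> (\<forall>x\<in>V. \<forall>y\<in>V. x \<noteq> y \<longrightarrow> (alternate x y w \<longleftrightarrow> {x, y} \<in> E))"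

definition order_isomorphic :: "'a::linorder list \<Rightarrow> 'b::linorder list \<Rightarrow> bool" where
  "order_isomorphic u v \<longleftrightarrow>
     length u = length v \<and>
     (\<forall>i < length u. \<forall>j < length u. u ! i < u ! j \<longleftrightarrow> v ! i < v ! j)"

definition contains_pattern :: "'a::linorder list \<Rightarrow> nat list \<Rightarrow> bool" where
  "contains_pattern w \<tau> \<longleftrightarrow> (\<exists>u. subseq u w \<and> order_isomorphic u \<tau>)"

abbreviation avoids :: "'a::linorder list \<Rightarrow> nat list \<Rightarrow> bool" where
  "avoids w \<tau> \<equiv> \<not> contains_pattern w \<tau>"

end

theory Submission
  imports Defs
begin

text \<open>If \<open>x\<close> occurs at least \<open>k + 1\<close> times in \<open>w\<close>, then \<open>w\<close> has \<open>k\<close> gaps between consecutive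
  occurrences of \<open>x\<close>, and every gap contains every neighbour of \<open>x\<close>. Rank \<open>x\<close> and \<open>k\<close> of its
  neighbours by their order and arrange them as \<open>\<tau>\<close> prescribes. If \<open>x\<close> has \<open>p\<close> letters before it in
  this arrangement, then it can be placed at occurrence number \<open>p + 1\<close> of \<open>x\<close> in \<open>w\<close>; this leaves
  \<open>p\<close> gaps before and \<open>k - p\<close> gaps after it, one for each of the other letters.\<close>

text \<open>This word does not depend on where \<open>x\<close> stands among the other letters, so a
  single embedding of it into \<open>w\<close> serves every position of \<open>x\<close>.\<close>

fun pad :: "'a \<Rightarrow> 'a list \<Rightarrow> 'a list" where
  "pad x [] = [x]"
| "pad x (u # us) = x # u # pad x us"

lemma subseq_pad: "subseq us (pad x us)"
  by (induction us) (auto intro: list_emb_Cons)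

text \<open>Of all the copies of \<open>x\<close>, only the one between \<open>us\<close> and
  \<open>vs\<close> is kept.\<close>

lemma subseq_pad_insert: "subseq (us @ x # vs) (pad x (us @ vs))"
proof (induction us)
  case Nil
  then show ?case
    by (cases vs) (auto intro: subseq_pad)
next
  case (Cons u us)
  then show ?case
    by (auto intro: list_emb_Cons)
qed

lemma alternate_between:
  assumes "alternate x y (a @ x # b @ x # c)"
  shows "y \<in> set b"
proof -
  let ?w = "a @ x # b @ x # c"
  let ?i = "length a" and ?j = "length a + Suc (length b)"
  have "?w ! ?i = x" "?w ! ?j = x" "?i < ?j" "?j < length ?w"
    by (simp_all add: nth_append)
  then obtain m where m: "?i < m" "m < ?j" "?w ! m = y"
    using assms unfolding alternate_def by blast
  then obtain n where "m = Suc (length a + n)" "n < length b"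
    using less_imp_Suc_add by fastforce
  with m show ?thesis
    by (auto simp: nth_append)
qed

text \<open>Greedy embedding: each gap between consecutive occurrences of \<open>x\<close> supplies
  the next letter of \<open>us\<close>, and \<open>length us\<close> gaps need one more occurrence
  than that.\<close>

lemma subseq_pad_if_between:
  assumes "\<And>a b c y. w = a @ x # b @ x # c \<Longrightarrow> y \<in> set us \<Longrightarrow> y \<in> set b"
    and "length us < count_list w x"
  shows "subseq (pad x us) w"
  using assms
proof (induction us arbitrary: w)
  case Nil
  then have "x \<in> set w"
    using count_notin by fastforce
  then show ?case
    by (simp add: subseq_singleton_left)
next
  case (Cons u us)
  have "x \<in> set w"
    using Cons.prems(2) count_notin by fastforce
  then obtain a v where w: "w = a @ x # v" "x \<notin> set a"
    by (meson split_list_first)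
  then have v: "length us < count_list v x"
    using Cons.prems(2) by simp
  then have "x \<in> set v"
    using count_notin by fastforce
  then obtain b c where bc: "v = b @ x # c" "x \<notin> set b"
    by (meson split_list_first)
  \<comment> \<open>The \<open>x\<close> closing the first gap also opens the next one, so the
    induction hypothesis is applied to \<open>x # c\<close> and not to \<open>c\<close>.\<close>
  have "subseq (pad x us) (x # c)"
  proof (rule Cons.IH)
    show "y \<in> set b'" if "x # c = a' @ x # b' @ x # c'" "y \<in> set us" for a' b' c' y
      using Cons.prems(1)[of "a @ x # b @ a'" b' c' y] that w(1) bc(1) by simp
    show "length us < count_list (x # c) x"
      using v bc by simp
  qed
  moreover have "u \<in> set b"
    using Cons.prems(1) w(1) bc(1) by simp
  ultimately have "subseq ([u] @ pad x us) (b @ x # c)"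
    by (intro list_emb_append_mono) (auto simp: subseq_singleton_left)
  then have "subseq (x # u # pad x us) (x # b @ x # c)"
    by simp
  then show ?case
    unfolding w(1) bc(1) pad.simps by (rule list_emb_append2)
qed

text \<open>The entries of \<open>\<tau>\<close> are read as ranks: each \<open>i\<close> is
  replaced by the \<open>i\<close>-th smallest element of \<open>A\<close>.\<close>

lemma exists_order_isomorphic_arrangement:
  fixes A :: "'a::linorder set"
  assumes "\<tau> \<in> permutations_of_set {1..n}" and "finite A" and "card A = n"
  obtains u where "distinct u" "set u = A" "order_isomorphic u \<tau>"
proof
  define L where "L = sorted_list_of_set A"
  \<comment> \<open>Ranks start at 1, list positions at 0.\<close>
  define f where "f = (\<lambda>i. L ! (i - 1))"
  have \<tau>: "set \<tau> = {1..n}" "distinct \<tau>"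
    using assms(1) by (auto dest: permutations_of_setD)
  have L: "length L = n" "set L = A" "sorted_wrt (<) L"
    using assms by (auto simp: L_def)
  have mono: "strict_mono_on {1..n} f"
    using sorted_wrt_nth_less[OF L(3)] L(1) by (auto simp: strict_mono_on_def f_def)
  then show "distinct (map f \<tau>)"
    using \<tau> by (simp add: distinct_map strict_mono_on_imp_inj_on)
  have "f ` {1..n} = (\<lambda>i. f (Suc i)) ` {..<n}"
    by (simp only: image_image[symmetric] lessThan_atLeast0 image_Suc_atLeastLessThan
        atLeastLessThanSuc_atLeastAtMost One_nat_def)
  also have "\<dots> = A"
    using L by (auto simp: f_def in_set_conv_nth)
  finally show "set (map f \<tau>) = A"
    using \<tau> by simp
  have "\<tau> ! i \<in> {1..n}" if "i < length \<tau>" for i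
    using that \<tau>(1) nth_mem by blast
  then show "order_isomorphic (map f \<tau>) \<tau>"
    using strict_mono_on_less[OF mono] by (simp add: order_isomorphic_def)
qed

lemma degree_geE:
  assumes "enat k \<le> degree V E x"
  obtains N where "finite N" "N \<subseteq> nbhd V E x" "card N = k"
proof (cases "finite (nbhd V E x)")
  case True
  then show ?thesis
    using assms that by (auto simp: degree_def elim: obtain_subset_with_card_n)
next
  case False
  then show ?thesis
    using infinite_arbitrarily_large that by blast
qed

theorem theorem3p1:
  fixes k :: nat and \<tau> :: "nat list"
    and V :: "'a::linorder set" and E :: "'a set set" and x :: 'a
  assumes "k \<ge> 1"
    and "\<tau> \<in> permutations_of_set {1..k + 1}"
    and "simple_graph V E"
    and "\<exists>w. represents w V E \<and> avoids w \<tau>"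
    and "x \<in> V"
    and "degree V E x \<ge> enat k"
  shows "\<forall>w. represents w V E \<and> avoids w \<tau> \<longrightarrow> count_list w x \<le> k"
proof (intro allI impI, rule ccontr)
  fix w
  assume w: "represents w V E \<and> avoids w \<tau>" and "\<not> count_list w x \<le> k"
  then have count: "k < count_list w x"
    by simp
  obtain N where N: "finite N" "N \<subseteq> nbhd V E x" "card N = k"
    using degree_geE[OF assms(6)] .
  \<comment> \<open>A loop would be the singleton \<open>{x, x}\<close>, whose cardinality is not 2.
    Hence \<open>x\<close> and \<open>N\<close> together give \<open>k + 1\<close> letters.\<close>
  have "x \<notin> nbhd V E x"
    using assms(3) by (auto simp: nbhd_def simple_graph_def)
  have alt: "alternate x y w" if "y \<in> N" for y
  proof -
    have "y \<in> V" "{x, y} \<in> E" "x \<noteq> y"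
      using that N(2) \<open>x \<notin> nbhd V E x\<close> by (auto simp: nbhd_def)
    then show ?thesis
      using w assms(5) by (simp add: represents_def)
  qed
  have "card (insert x N) = k + 1"
    using N \<open>x \<notin> nbhd V E x\<close> by (auto simp: card_insert_if)
  then obtain u where u: "distinct u" "set u = insert x N" "order_isomorphic u \<tau>"
    using exists_order_isomorphic_arrangement[OF assms(2)] N(1) by blast
  obtain us vs where split: "u = us @ x # vs"
    using u(2) by (metis insertI1 split_list)
  have "length u = k + 1"
    using u \<open>card (insert x N) = k + 1\<close> by (metis distinct_card)
  then have "length (us @ vs) < count_list w x"
    using count split by simp
  \<comment> \<open>Since \<open>u\<close> is distinct, \<open>x\<close> does not occur again in
    \<open>us\<close> or \<open>vs\<close>.\<close>
  have "set (us @ vs) \<subseteq> N"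
    using u(1,2) split by auto
  have "y \<in> set b" if "w = a @ x # b @ x # c" "y \<in> set (us @ vs)" for a b c y
  proof (rule alternate_between)
    show "alternate x y (a @ x # b @ x # c)"
      using alt[OF subsetD[OF \<open>set (us @ vs) \<subseteq> N\<close> that(2)]] that(1) by simp
  qed
  then have "subseq (pad x (us @ vs)) w"
    using \<open>length (us @ vs) < count_list w x\<close> by (rule subseq_pad_if_between)
  then have "subseq u w"
    unfolding split by (rule subseq_order.trans[OF subseq_pad_insert])
  with u(3) w show False
    by (auto simp: contains_pattern_def)
qed

end
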